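(* Let $A$ be a complex square matrix. Let $a_1,\dots,a_k\in\mathbb{C}$ ($k\ge 1$) be distinct, let $\alpha_1,\dots,\alpha_k$ be nonnegative integers, put $$Q(z)=(z-a_1)^{\alpha_1+1}\cdots(z-a_k)^{\alpha_k+1},$$ and assume $Q(A)=0$. For $1\le p\le k$ put $Q_p(z)=Q(z)/(z-a_p)^{\alpha_p+1}$, and for each integer $n\ge 0$ let $b_{p,n}$ be the $n$-th Taylor coefficient of $1/Q_p(z)$ at $z=a_p$. Let $f$ be an entire function, and let $P(f(z),z)\in\mathbb{C}[z]$ be $Q(z)$ times the singular part of $f(z)/Q(z)$. Then: (1) for all $1\le p\le k$ and all $n\ge 0$, $$b_{p,n}=(-1)^n\sum_{\beta\in\mathbb{N}^k,\ \beta_p=0,\ |\beta|=n}\ \ \prod_{1\le j\le k,\ j\ne p}\binom{\alpha_j+\beta_j}{\alpha_j}\,\frac{1}{(a_p-a_j)^{\alpha_j+1+\beta_j}},$$ where $|\beta|:=\beta_1+\cdots+\beta_k$; (2) $$P(f(z),z)=\sum_{p=1}^k\ \sum_{q=0}^{\alpha_p}\ \sum_{j=0}^q\ \frac{f^{(j)}(a_p)}{j!}\ b_{p,q-j}\ (z-a_p)^q\ Q_p(z);$$ (3) $f(A)=P(f(z),A)$, i.e. $f(A)$ is obtained by evaluating the polynomial $P(f(z),z)$ at $z=A$.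
   Context: $\mathbb{N}=\{0,1,2,\dots\}$. The $n$-th Taylor coefficient of $g$ at $a$ is the coefficient of $(z-a)^n$ in the Taylor expansion of $g$ at $a$. The singular part of the meromorphic function $f(z)/Q(z)$ is the sum, over its poles, of the principal parts of its Laurent expansions (the terms with negative exponents); multiplied by $Q(z)$ it is a polynomial, denoted $P(f(z),z)$. For an entire function $f(z)=\sum_{n\ge0} c_n z^n$, $f(A)=\sum_{n\ge0} c_nA^n$. Empty products equal $1$. *)

theory Defs
  imports "HOL-Complex_Analysis.Complex_Analysis"
begin

definition Q_poly :: "nat \<Rightarrow> (nat \<Rightarrow> complex) \<Rightarrow> (nat \<Rightarrow> nat) \<Rightarrow> complex poly" where
  "Q_poly k a \<alpha> = (\<Prod>j=1..k. [:- a j, 1:] ^ (\<alpha> j + 1))"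

definition Qp_poly :: "nat \<Rightarrow> (nat \<Rightarrow> complex) \<Rightarrow> (nat \<Rightarrow> nat) \<Rightarrow> nat \<Rightarrow> complex poly" where
  "Qp_poly k a \<alpha> p = Q_poly k a \<alpha> div [:- a p, 1:] ^ (\<alpha> p + 1)"

definition taylor_coeff :: "(complex \<Rightarrow> complex) \<Rightarrow> complex \<Rightarrow> nat \<Rightarrow> complex" where
  "taylor_coeff g a n = fps_nth (fps_expansion g a) n"

definition b_coeff :: "nat \<Rightarrow> (nat \<Rightarrow> complex) \<Rightarrow> (nat \<Rightarrow> nat) \<Rightarrow> nat \<Rightarrow> nat \<Rightarrow> complex" where
  "b_coeff k a \<alpha> p n = taylor_coeff (\<lambda>z. 1 / poly (Qp_poly k a \<alpha> p) z) (a p) n"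

(* fls_prpart F is the polynomial in the inverse of the variable made of the
   terms of F with negative exponents, hence the evaluation at 1 / (z - w). *)
definition singular_part :: "(complex \<Rightarrow> complex) \<Rightarrow> complex \<Rightarrow> complex" where
  "singular_part g z =
     (\<Sum>w\<in>{w. is_pole g w}. poly (fls_prpart (laurent_expansion g w)) (1 / (z - w)))"

(* Off the zeros of Q only, since the value of f / Q at a zero of Q is a junk value. *)
definition sing_poly :: "(complex \<Rightarrow> complex) \<Rightarrow> complex poly \<Rightarrow> complex poly" where
  "sing_poly f Q = (THE P. \<forall>z. poly Q z \<noteq> 0 \<longrightarrow>
     poly P z = poly Q z * singular_part (\<lambda>w. f w / poly Q w) z)"

(* The type class power on vectors of vectors is entrywise, so matrix powers are
   defined from the matrix product. *)
primrec matrix_power :: "complex^'n^'n \<Rightarrow> nat \<Rightarrow> complex^'n^'n" where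
  "matrix_power A 0 = mat 1"
| "matrix_power A (Suc n) = A ** matrix_power A n"

definition matrix_smult :: "complex \<Rightarrow> complex^'n^'n \<Rightarrow> complex^'n^'n" where
  "matrix_smult c A = map_matrix (\<lambda>x. c * x) A"

definition poly_matrix :: "complex poly \<Rightarrow> complex^'n^'n \<Rightarrow> complex^'n^'n" where
  "poly_matrix P A = (\<Sum>i\<le>degree P. matrix_smult (coeff P i) (matrix_power A i))"

text \<open>Existence and uniqueness of the polynomial described by \<^const>\<open>sing_poly\<close>.\<close>

lemma degree_prpart_quotient_le:
  fixes Q :: "complex poly"
  assumes f: "f holomorphic_on UNIV" and Q: "Q \<noteq> 0"
  shows "degree (fls_prpart (laurent_expansion (\<lambda>z. f z / poly Q z) w)) \<le> order w Q"
proof -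
  define m where "m = order w Q"
  obtain R where R: "Q = [:- w, 1:] ^ m * R" and nz: "poly R w \<noteq> 0"
    using order_decomp[OF Q, of w] unfolding m_def by (metis poly_eq_0_iff_dvd)
  define H where "H = fps_expansion (\<lambda>z. f z / poly R z) w"
  have "f analytic_on {w}"
    using f by (auto simp: analytic_on_open intro: analytic_on_subset[of f UNIV])
  moreover have polyR: "poly R analytic_on {w}"
  proof (rule analytic_on_subset)
    show "poly R analytic_on UNIV"
      by (auto simp: analytic_on_open holomorphic_on_def field_differentiable_def intro: poly_DERIV)
  qed auto
  ultimately have "(\<lambda>z. f z / poly R z) analytic_on {w}"
    using nz polyR by (intro analytic_intros) auto
  hence "(\<lambda>x. f (w + x) / poly R (w + x)) has_laurent_expansion fps_to_fls H"
    unfolding H_def by (intro has_laurent_expansion_fps analytic_at_imp_has_fps_expansion)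
  from has_laurent_expansion_shift'[OF this, of "int m"]
  have "(\<lambda>x. f (w + x) / poly Q (w + x)) has_laurent_expansion fls_shift (int m) (fps_to_fls H)"
    by (simp add: R power_int_minus field_simps)
  hence eq: "laurent_expansion (\<lambda>z. f z / poly Q z) w = fls_shift (int m) (fps_to_fls H)"
    by (rule laurent_expansion_eqI)
  show ?thesis
    unfolding eq m_def[symmetric] by (intro degree_le) auto
qed

lemma sing_poly_exists_unique:
  fixes Q :: "complex poly"
  assumes f: "f holomorphic_on UNIV" and Q: "Q \<noteq> 0"
  shows "\<exists>!P. \<forall>z. poly Q z \<noteq> 0 \<longrightarrow>
     poly P z = poly Q z * singular_part (\<lambda>w. f w / poly Q w) z"
proof -
  define g where "g = (\<lambda>w. f w / poly Q w)"
  have "\<exists>P. \<forall>z. poly Q z \<noteq> 0 \<longrightarrow>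
          poly P z = poly Q z * poly (fls_prpart (laurent_expansion g w)) (1 / (z - w))" for w
  proof -
    define m where "m = order w Q"
    define S where "S = fls_prpart (laurent_expansion g w)"
    have deg: "degree S \<le> m"
      using degree_prpart_quotient_le[OF assms] by (simp add: S_def g_def m_def)
    obtain R where R: "Q = [:- w, 1:] ^ m * R"
      using order_1[of w Q] unfolding m_def dvd_def by auto
    define P where "P = R * (\<Sum>i\<le>degree S. smult (coeff S i) ([:- w, 1:] ^ (m - i)))"
    have "poly P z = poly Q z * poly S (1 / (z - w))" if z: "poly Q z \<noteq> 0" for z
    proof (cases "z = w")
      case True
      have "m = 0" using z True by (simp add: m_def order_root)
      with deg have "degree S = 0" by simp
      then obtain c where "S = [:c:]" by (metis degree_eq_zeroE)
      thus ?thesis using \<open>m = 0\<close> by (simp add: P_def R)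
    next
      case False
      have "(z - w) ^ (m - i) = (z - w) ^ m * (1 / (z - w)) ^ i" if "i \<le> degree S" for i
        using False deg that by (simp add: power_diff power_one_over)
      thus ?thesis
        by (simp add: P_def R poly_altdef[of S] poly_sum sum_distrib_left algebra_simps)
    qed
    thus ?thesis unfolding S_def by blast
  qed
  then obtain P where P: "\<And>w z. poly Q z \<noteq> 0 \<Longrightarrow>
     poly (P w) z = poly Q z * poly (fls_prpart (laurent_expansion g w)) (1 / (z - w))"
    by metis
  show ?thesis
  proof (rule ex1I)
    show "\<forall>z. poly Q z \<noteq> 0 \<longrightarrow> poly (\<Sum>w\<in>{w. is_pole g w}. P w) z =
            poly Q z * singular_part (\<lambda>w. f w / poly Q w) z"
      by (auto simp: singular_part_def poly_sum P sum_distrib_left g_def[symmetric])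
  next
    fix P'
    assume P': "\<forall>z. poly Q z \<noteq> 0 \<longrightarrow> poly P' z = poly Q z * singular_part (\<lambda>w. f w / poly Q w) z"
    define D where "D = P' - (\<Sum>w\<in>{w. is_pole g w}. P w)"
    have "poly D z = 0" if "poly Q z \<noteq> 0" for z
      using P' that by (simp add: D_def singular_part_def poly_sum P sum_distrib_left g_def[symmetric])
    hence "poly (D * Q) z = 0" for z by (cases "poly Q z = 0") auto
    hence "D * Q = 0" using poly_all_0_iff_0 by blast
    with Q show "P' = (\<Sum>w\<in>{w. is_pole g w}. P w)" by (simp add: D_def)
  qed
qed

end

(* P(f) is the Hermite interpolation polynomial of f at the roots of Q. Near a_p the quotient f/Q is
   (f/Q_p) / (z - a_p)^(alpha_p+1), so its principal part comes from the Taylor polynomial of f * (1/Q_p),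
   which gives (2); expanding 1/Q_p as a product of negative binomial series gives (1).
   For (3), if F is a polynomial then F - P(F) vanishes at each a_p to order alpha_p + 1, so Q divides it
   and F(A) = P(F)(A). Now P(f) depends linearly on the finitely many numbers f^(j)(a_p), and these are
   obtained from the Taylor series of f by termwise differentiation. Hence
   P(f)(A) = sum_n c_n P(z^n)(A) = sum_n c_n A^n, which also yields convergence without any norm estimate. *)
theory Submission
  imports Defs
begin

subsection \<open>The Taylor coefficients of the inverse cofactors\<close>

lemma fps_expansion_shift_eqI:
  assumes "(\<lambda>x. f (w + x)) has_fps_expansion F"
  shows "fps_expansion f w = F"
  using analytic_at_imp_has_fps_expansion[OF has_fps_expansion_imp_analytic[OF assms]] assms
  by (rule fps_expansion_unique_complex)

text \<open>For \<open>c\<close> nonzero this is the negative binomial series of (c + X)^-(m+1),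
  with its coefficients in the closed form that (1) requires.\<close>

definition inv_linear_power_fps :: "complex \<Rightarrow> nat \<Rightarrow> complex fps" where
  "inv_linear_power_fps c m = Abs_fps (\<lambda>n. (-1) ^ n * of_nat ((m + n) choose m) / c ^ (m + 1 + n))"

lemma linear_mult_inv_linear_power_fps_0:
  assumes "c \<noteq> 0"
  shows "(fps_const c + fps_X) * inv_linear_power_fps c 0 = 1"
proof (rule fps_ext)
  fix n
  show "fps_nth ((fps_const c + fps_X) * inv_linear_power_fps c 0) n = fps_nth 1 n"
    using assms by (cases n) (simp_all add: distrib_right inv_linear_power_fps_def)
qed

text \<open>Each positive coefficient on the left combines two neighbouring coefficients of opposite
  sign, so the identity reduces to Pascal's rule. It is the induction step that leads from the
  geometric series to higher exponents.\<close>

lemma linear_mult_inv_linear_power_fps_Suc: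
  assumes "c \<noteq> 0"
  shows "(fps_const c + fps_X) * inv_linear_power_fps c (Suc m) = inv_linear_power_fps c m"
proof (rule fps_ext)
  fix n
  show "fps_nth ((fps_const c + fps_X) * inv_linear_power_fps c (Suc m)) n
      = fps_nth (inv_linear_power_fps c m) n"
  proof (cases n)
    case 0
    then show ?thesis
      using assms by (simp add: distrib_right inv_linear_power_fps_def)
  next
    case (Suc i)
    have "of_nat (Suc (Suc (m + i)) choose Suc m)
        = (of_nat (Suc (m + i) choose Suc m) + of_nat (Suc (m + i) choose m) :: complex)"
      by simp
    then show ?thesis
      using assms Suc by (simp add: distrib_right inv_linear_power_fps_def field_simps)
  qed
qed

lemma linear_power_mult_inv_linear_power_fps:
  assumes "c \<noteq> 0"
  shows "(fps_const c + fps_X) ^ (m + 1) * inv_linear_power_fps c m = 1"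
proof (induction m)
  case 0
  then show ?case using linear_mult_inv_linear_power_fps_0[OF assms] by simp
next
  case (Suc m)
  have "(fps_const c + fps_X) ^ (Suc m + 1) * inv_linear_power_fps c (Suc m)
      = (fps_const c + fps_X) ^ (m + 1) * ((fps_const c + fps_X) * inv_linear_power_fps c (Suc m))"
    by (simp only: power_Suc add_Suc mult_ac)
  then show ?case
    by (simp only: linear_mult_inv_linear_power_fps_Suc[OF assms] Suc)
qed

section \<open>Coefficients of a finite product of power series\<close>

lemma finite_PiE_nat_sum_eq:
  assumes "finite S"
  shows "finite {\<beta> \<in> S \<rightarrow>\<^sub>E (UNIV :: nat set). sum \<beta> S = n}"
proof (rule finite_subset)
  show "{\<beta> \<in> S \<rightarrow>\<^sub>E (UNIV :: nat set). sum \<beta> S = n} \<subseteq> S \<rightarrow>\<^sub>E {..n}"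
  proof clarify
    fix \<beta> :: "'a \<Rightarrow> nat" assume "\<beta> \<in> S \<rightarrow>\<^sub>E UNIV"
    then show "\<beta> \<in> S \<rightarrow>\<^sub>E {..sum \<beta> S}"
      using assms by (auto simp: PiE_iff intro: member_le_sum)
  qed
qed (use assms in \<open>simp add: finite_PiE\<close>)

text \<open>Iterated Cauchy product: an exponent \<open>i\<close> spent on a new factor leaves
  \<open>n - i\<close> for the others. Extensional functions count each family of exponents once and
  keep the index set finite.\<close>

lemma fps_nth_prod_eq_sum_PiE:
  fixes F :: "'b \<Rightarrow> 'a :: comm_ring_1 fps"
  assumes "finite S"
  shows "fps_nth (\<Prod>j\<in>S. F j) n
    = (\<Sum>\<beta> \<in> {\<beta> \<in> S \<rightarrow>\<^sub>E (UNIV :: nat set). sum \<beta> S = n}. \<Prod>j\<in>S. fps_nth (F j) (\<beta> j))"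
  using assms
proof (induction S arbitrary: n rule: finite_induct)
  case empty
  show ?case by (cases "n = 0") auto
next
  case (insert x S)
  let ?B = "\<lambda>S n. {\<beta> \<in> S \<rightarrow>\<^sub>E (UNIV :: nat set). sum \<beta> S = n}"
  have sum_upd: "(\<Sum>j\<in>S. if j = x then i else \<beta> j) = sum \<beta> S" for \<beta> :: "'b \<Rightarrow> nat" and i
    using insert.hyps by (intro sum.cong) auto
  have "fps_nth (\<Prod>j\<in>insert x S. F j) n
      = (\<Sum>i\<in>{0..n}. fps_nth (F x) i * (\<Sum>\<beta>\<in>?B S (n - i). \<Prod>j\<in>S. fps_nth (F j) (\<beta> j)))"
    using insert by (simp add: fps_mult_nth)
  also have "\<dots> = (\<Sum>(i,\<beta>)\<in>Sigma {0..n} (\<lambda>i. ?B S (n - i)).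
                    fps_nth (F x) i * (\<Prod>j\<in>S. fps_nth (F j) (\<beta> j)))"
    using insert.hyps by (simp add: sum_distrib_left sum.Sigma finite_PiE_nat_sum_eq)
  also have "\<dots> = (\<Sum>\<beta>\<in>?B (insert x S) n. \<Prod>j\<in>insert x S. fps_nth (F j) (\<beta> j))"
  \<comment> \<open>The exponent \<open>i\<close> is attached to a family on \<open>S\<close> as its
    value at \<open>x\<close>; on the way back \<open>restrict\<close> resets that value to
    \<open>undefined\<close>.\<close>
  proof (rule sum.reindex_bij_witness[where j = "\<lambda>(i,\<beta>). \<beta>(x := i)"
                                        and i = "\<lambda>\<beta>. (\<beta> x, restrict \<beta> S)"])
    fix p assume p: "p \<in> Sigma {0..n} (\<lambda>i. ?B S (n - i))"
    define i \<beta> where "i = fst p" and "\<beta> = snd p"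
    then have p_eq: "p = (i, \<beta>)" by simp
    with p have "restrict (\<beta>(x := i)) S = \<beta>"
      using insert.hyps by (auto simp: PiE_def extensional_def restrict_def)
    then show "((case p of (i, \<beta>) \<Rightarrow> \<beta>(x := i)) x, restrict (case p of (i, \<beta>) \<Rightarrow> \<beta>(x := i)) S) = p"
      by (simp add: p_eq)
    show "(case p of (i, \<beta>) \<Rightarrow> \<beta>(x := i)) \<in> ?B (insert x S) n"
      using p insert.hyps by (auto simp: p_eq sum_upd PiE_def extensional_def)
    have "(\<Prod>j\<in>S. fps_nth (F j) ((\<beta>(x := i)) j)) = (\<Prod>j\<in>S. fps_nth (F j) (\<beta> j))"
      using insert.hyps by (intro prod.cong) auto
    then show "(\<Prod>j\<in>insert x S. fps_nth (F j) ((case p of (i, \<beta>) \<Rightarrow> \<beta>(x := i)) j))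
        = (case p of (i, \<beta>) \<Rightarrow> fps_nth (F x) i * (\<Prod>j\<in>S. fps_nth (F j) (\<beta> j)))"
      using insert.hyps by (simp add: p_eq)
  next
    fix \<beta> assume \<beta>: "\<beta> \<in> ?B (insert x S) n"
    show "(case (\<beta> x, restrict \<beta> S) of (i, \<beta>) \<Rightarrow> \<beta>(x := i)) = \<beta>"
      using \<beta> by (auto simp: PiE_def extensional_def fun_eq_iff)
    show "(\<beta> x, restrict \<beta> S) \<in> Sigma {0..n} (\<lambda>i. ?B S (n - i))"
      using \<beta> insert.hyps by auto
  qed
  finally show ?case .
qed

section \<open>The cofactor Q_p and the expansion of its inverse at a_p\<close>

lemma Q_poly_remove:
  assumes "p \<in> {1..k}"
  shows "Q_poly k a \<alpha>
    = [:- a p, 1:] ^ (\<alpha> p + 1) * (\<Prod>j\<in>{1..k} - {p}. [:- a j, 1:] ^ (\<alpha> j + 1))"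
  unfolding Q_poly_def by (rule prod.remove[OF finite_atLeastAtMost assms])

lemma Qp_poly_eq:
  assumes "p \<in> {1..k}"
  shows "Qp_poly k a \<alpha> p = (\<Prod>j\<in>{1..k} - {p}. [:- a j, 1:] ^ (\<alpha> j + 1))"
  unfolding Qp_poly_def Q_poly_remove[OF assms]
  by (rule nonzero_mult_div_cancel_left) (simp del: power_Suc add: power_eq_0_iff)

lemma Q_poly_eq_mult_Qp_poly:
  assumes "p \<in> {1..k}"
  shows "Q_poly k a \<alpha> = [:- a p, 1:] ^ (\<alpha> p + 1) * Qp_poly k a \<alpha> p"
  unfolding Qp_poly_eq[OF assms] by (rule Q_poly_remove[OF assms])

lemma pcompose_power: "(P ^ n) \<circ>\<^sub>p R = (P \<circ>\<^sub>p R) ^ n" for P :: "'a :: comm_semiring_1 poly"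
  by (induction n) (simp_all add: pcompose_mult pcompose_1)

text \<open>The candidate for the expansion of 1/Q_p in powers of z - a_p: since z - a_j = (a_p -
  a_j) + (z - a_p), each linear factor contributes one negative binomial series.\<close>

definition b_fps :: "nat \<Rightarrow> (nat \<Rightarrow> complex) \<Rightarrow> (nat \<Rightarrow> nat) \<Rightarrow> nat \<Rightarrow> complex fps" where
  "b_fps k a \<alpha> p = (\<Prod>j\<in>{1..k} - {p}. inv_linear_power_fps (a p - a j) (\<alpha> j))"

text \<open>Composition with w + X re-expands a polynomial around \<open>w\<close>, so its
  coefficients become the Taylor coefficients there.\<close>

lemma has_fps_expansion_poly_shift:
  "(\<lambda>x. poly P (w + x)) has_fps_expansion fps_of_poly (P \<circ>\<^sub>p [:w, 1:])" for P :: "complex poly"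
proof -
  have "(\<lambda>x. poly P (w + x)) = eval_fps (fps_of_poly (P \<circ>\<^sub>p [:w, 1:]))"
    by (auto simp: poly_pcompose fun_eq_iff)
  moreover have "eval_fps (fps_of_poly (P \<circ>\<^sub>p [:w, 1:])) has_fps_expansion fps_of_poly (P \<circ>\<^sub>p [:w, 1:])"
    by (rule eval_fps_has_fps_expansion) simp
  ultimately show ?thesis by simp
qed

lemma Qp_fps_mult_b_fps:
  assumes "inj_on a {1..k}" "p \<in> {1..k}"
  shows "fps_of_poly (Qp_poly k a \<alpha> p \<circ>\<^sub>p [:a p, 1:]) * b_fps k a \<alpha> p = 1"
proof -
  have "fps_of_poly (Qp_poly k a \<alpha> p \<circ>\<^sub>p [:a p, 1:])
      = (\<Prod>j\<in>{1..k} - {p}. (fps_const (a p - a j) + fps_X) ^ (\<alpha> j + 1))"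
    unfolding Qp_poly_eq[OF assms(2)] pcompose_prod fps_of_poly_prod
    by (intro prod.cong refl)
       (simp add: pcompose_power pcompose_pCons fps_of_poly_power fps_of_poly_pCons add_ac
             del: power_Suc flip: fps_of_poly_mult)
  then have "fps_of_poly (Qp_poly k a \<alpha> p \<circ>\<^sub>p [:a p, 1:]) * b_fps k a \<alpha> p
      = (\<Prod>j\<in>{1..k} - {p}. (fps_const (a p - a j) + fps_X) ^ (\<alpha> j + 1)
            * inv_linear_power_fps (a p - a j) (\<alpha> j))"
    unfolding b_fps_def by (simp only: prod.distrib)
  also have "\<dots> = 1"
  proof (intro prod.neutral ballI linear_power_mult_inv_linear_power_fps)
    \<comment> \<open>Distinctness of the nodes makes the constant terms of the linear factors
      nonzero.\<close>
    show "a p - a j \<noteq> 0" if "j \<in> {1..k} - {p}" for j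
      using assms that by (auto dest: inj_onD)
  qed
  finally show ?thesis .
qed

lemma inverse_Qp_has_fps_expansion:
  assumes "inj_on a {1..k}" "p \<in> {1..k}"
  shows "(\<lambda>x. 1 / poly (Qp_poly k a \<alpha> p) (a p + x)) has_fps_expansion b_fps k a \<alpha> p"
proof -
  let ?G = "fps_of_poly (Qp_poly k a \<alpha> p \<circ>\<^sub>p [:a p, 1:])"
  have one: "?G * b_fps k a \<alpha> p = 1" using Qp_fps_mult_b_fps[OF assms] .
  \<comment> \<open>Inverting an expansion requires a nonzero constant term; it is read off from the
    product being 1.\<close>
  then have "fps_nth ?G 0 * fps_nth (b_fps k a \<alpha> p) 0 = 1"
    by (metis fps_mult_nth_0 fps_one_nth)
  then have nz: "fps_nth ?G 0 \<noteq> 0" by auto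
  have "inverse ?G = b_fps k a \<alpha> p"
    using one by (metis fps_inverse_unique)
  with has_fps_expansion_inverse[OF has_fps_expansion_poly_shift nz] show ?thesis
    by (simp add: inverse_eq_divide)
qed

lemma b_coeff_eq_fps_nth:
  assumes "inj_on a {1..k}" "p \<in> {1..k}"
  shows "b_coeff k a \<alpha> p n = fps_nth (b_fps k a \<alpha> p) n"
  unfolding b_coeff_def taylor_coeff_def
  by (subst fps_expansion_shift_eqI[OF inverse_Qp_has_fps_expansion[OF assms]]) simp

lemma b_coeff_formula:
  assumes "inj_on a {1..k}" "p \<in> {1..k}"
  shows "b_coeff k a \<alpha> p n =
           (-1) ^ n *
           (\<Sum>\<beta> \<in> {\<beta> \<in> {1..k} \<rightarrow>\<^sub>E (UNIV :: nat set). \<beta> p = 0 \<and> (\<Sum>j=1..k. \<beta> j) = n}.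
              \<Prod>j\<in>{1..k} - {p}.
                of_nat ((\<alpha> j + \<beta> j) choose \<alpha> j) * (1 / (a p - a j) ^ (\<alpha> j + 1 + \<beta> j)))"
proof -
  let ?S = "{1..k} - {p}"
  let ?t = "\<lambda>\<beta>. \<Prod>j\<in>?S. of_nat ((\<alpha> j + \<beta> j) choose \<alpha> j) * (1 / (a p - a j) ^ (\<alpha> j + 1 + \<beta> j))"
  have "b_coeff k a \<alpha> p n = (\<Sum>\<beta> \<in> {\<beta> \<in> ?S \<rightarrow>\<^sub>E UNIV. sum \<beta> ?S = n}.
          \<Prod>j\<in>?S. fps_nth (inv_linear_power_fps (a p - a j) (\<alpha> j)) (\<beta> j))"
    unfolding b_coeff_eq_fps_nth[OF assms] b_fps_def by (rule fps_nth_prod_eq_sum_PiE) simp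
  also have "\<dots> = (\<Sum>\<beta> \<in> {\<beta> \<in> ?S \<rightarrow>\<^sub>E UNIV. sum \<beta> ?S = n}. (-1) ^ n * ?t \<beta>)"
  proof (rule sum.cong[OF refl])
    fix \<beta> assume "\<beta> \<in> {\<beta> \<in> ?S \<rightarrow>\<^sub>E UNIV. sum \<beta> ?S = n}"
    then have n: "sum \<beta> ?S = n" by blast
    \<comment> \<open>Since \<beta> has total \<open>n\<close>, the global sign splits into one sign
      for each factor.\<close>
    have "(-1) ^ n = (\<Prod>j\<in>?S. (-1) ^ \<beta> j :: complex)"
      unfolding n[symmetric] by (rule power_sum)
    then have "(-1) ^ n * ?t \<beta> = (\<Prod>j\<in>?S. (-1) ^ \<beta> j *
        (of_nat ((\<alpha> j + \<beta> j) choose \<alpha> j) * (1 / (a p - a j) ^ (\<alpha> j + 1 + \<beta> j))))"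
      by (simp only: prod.distrib)
    then show "(\<Prod>j\<in>?S. fps_nth (inv_linear_power_fps (a p - a j) (\<alpha> j)) (\<beta> j)) = (-1) ^ n * ?t \<beta>"
      by (simp only: inv_linear_power_fps_def fps_nth_Abs_fps mult.assoc times_divide_eq_right mult_1_right)
  qed
  also have "\<dots> = (-1) ^ n * (\<Sum>\<beta> \<in> {\<beta> \<in> ?S \<rightarrow>\<^sub>E UNIV. sum \<beta> ?S = n}. ?t \<beta>)"
    by (simp add: sum_distrib_left)
  also have "(\<Sum>\<beta> \<in> {\<beta> \<in> ?S \<rightarrow>\<^sub>E UNIV. sum \<beta> ?S = n}. ?t \<beta>)
      = (\<Sum>\<beta> \<in> {\<beta> \<in> {1..k} \<rightarrow>\<^sub>E UNIV. \<beta> p = 0 \<and> (\<Sum>j=1..k. \<beta> j) = n}. ?t \<beta>)"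
  \<comment> \<open>A family without the index \<open>p\<close> corresponds to a family on
    \<open>{1..k}\<close> with entry 0 at \<open>p\<close>, which leaves the total unchanged;
    \<open>restrict\<close> turns that entry back into \<open>undefined\<close>.\<close>
  proof (rule sum.reindex_bij_witness[where j = "\<lambda>\<beta>. \<beta>(p := 0)" and i = "\<lambda>\<beta>. restrict \<beta> ?S"])
    fix \<beta> assume \<beta>: "\<beta> \<in> {\<beta> \<in> ?S \<rightarrow>\<^sub>E (UNIV :: nat set). sum \<beta> ?S = n}"
    then show "restrict (\<beta>(p := 0)) ?S = \<beta>"
      by (auto simp: PiE_def extensional_def restrict_def)
    have "(\<Sum>j\<in>{1..k}. (\<beta>(p := 0)) j) = sum \<beta> ?S"
      using assms by (subst sum.remove[of _ p]) (auto intro: sum.cong)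
    with \<beta> assms show "\<beta>(p := 0) \<in> {\<beta> \<in> {1..k} \<rightarrow>\<^sub>E UNIV. \<beta> p = 0 \<and> (\<Sum>j=1..k. \<beta> j) = n}"
      by (auto simp: PiE_def extensional_def)
    show "?t (\<beta>(p := 0)) = ?t \<beta>"
      by (rule prod.cong) auto
  next
    fix \<beta> assume \<beta>: "\<beta> \<in> {\<beta> \<in> {1..k} \<rightarrow>\<^sub>E (UNIV :: nat set). \<beta> p = 0 \<and> (\<Sum>j=1..k. \<beta> j) = n}"
    then show "(restrict \<beta> ?S)(p := 0) = \<beta>"
      by (auto simp: PiE_def extensional_def fun_eq_iff)
    show "restrict \<beta> ?S \<in> {\<beta> \<in> ?S \<rightarrow>\<^sub>E (UNIV :: nat set). sum \<beta> ?S = n}"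
      using \<beta> sum.remove[OF finite_atLeastAtMost assms(2), of \<beta>] by auto
  qed
  finally show ?thesis .
qed

subsection \<open>The singular part\<close>

text \<open>In y^-(m+1) H(y) only the coefficients of \<open>H\<close> with index at most
  \<open>m\<close> meet negative exponents, so the principal part is a truncation of
  \<open>H\<close> divided by y^(m+1).\<close>

lemma poly_fls_prpart_shift:
  fixes H :: "complex fps"
  assumes "y \<noteq> 0"
  shows "poly (fls_prpart (fls_shift (int (m + 1)) (fps_to_fls H))) (1 / y)
    = (\<Sum>q=0..m. fps_nth H q * y ^ q) / y ^ (m + 1)"
proof -
  define P where "P = fls_prpart (fls_shift (int (m + 1)) (fps_to_fls H))"
  \<comment> \<open>\<open>coeff P i\<close> belongs to y^-i, hence to index
    \<open>m + 1 - i\<close> of \<open>H\<close>; \<open>i = 0\<close> is excluded because the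
    constant term is not in the principal part.\<close>
  have coeff: "coeff P i = (if i = 0 \<or> i > m + 1 then 0 else fps_nth H (m + 1 - i))" for i
    by (auto simp: P_def nat_diff_distrib' nat_add_distrib)
  have "poly P (1 / y) = (\<Sum>i\<in>{1..m + 1}. coeff P i * (1 / y) ^ i)"
    unfolding poly_altdef
  \<comment> \<open>The degree of \<open>P\<close> is smaller than \<open>m + 1\<close> when
    \<open>H\<close> has zero constant term, so the sum is moved to a fixed range.\<close>
  proof (rule sum.mono_neutral_cong)
    show "coeff P i * (1 / y) ^ i = 0" if "i \<in> {1..m + 1} - {..degree P}" for i
      using that by (simp add: coeff_eq_0)
    show "coeff P i * (1 / y) ^ i = 0" if "i \<in> {..degree P} - {1..m + 1}" for i
      using that coeff[of i] by auto
  qed auto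
  also have "\<dots> = (\<Sum>q=0..m. fps_nth H q * (1 / y) ^ (m + 1 - q))"
    by (rule sum.reindex_bij_witness[where j = "\<lambda>i. m + 1 - i" and i = "\<lambda>q. m + 1 - q"])
       (auto simp: coeff)
  also have "\<dots> = (\<Sum>q=0..m. fps_nth H q * y ^ q / y ^ (m + 1))"
    using assms by (intro sum.cong refl) (simp add: power_one_over power_diff field_simps)
  finally show ?thesis by (simp add: sum_divide_distrib P_def)
qed

text \<open>The right-hand side of (2), kept as a function of \<open>f\<close> so that it applies to
  the given entire function as well as to polynomials, in particular monomials.\<close>

definition hermite_poly ::
    "nat \<Rightarrow> (nat \<Rightarrow> complex) \<Rightarrow> (nat \<Rightarrow> nat) \<Rightarrow> (complex \<Rightarrow> complex) \<Rightarrow> complex poly" where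
  "hermite_poly k a \<alpha> f = (\<Sum>p=1..k. \<Sum>q=0..\<alpha> p. \<Sum>j=0..q.
     smult ((deriv ^^ j) f (a p) / fact j * b_coeff k a \<alpha> p (q - j))
       ([:- a p, 1:] ^ q * Qp_poly k a \<alpha> p))"

text \<open>The sum over \<open>j\<close> in (2) is a Cauchy product: it is a Taylor coefficient of
  f/Q_p at a_p when \<open>f\<close> is analytic there.\<close>

lemma hermite_poly_eq:
  assumes "inj_on a {1..k}"
  shows "hermite_poly k a \<alpha> f = (\<Sum>p=1..k. (\<Sum>q=0..\<alpha> p.
     smult (fps_nth (fps_expansion f (a p) * b_fps k a \<alpha> p) q) ([:- a p, 1:] ^ q)) * Qp_poly k a \<alpha> p)"
  unfolding hermite_poly_def
  by (intro sum.cong refl)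
     (simp add: sum_distrib_right fps_mult_nth fps_expansion_def b_coeff_eq_fps_nth[OF assms] smult_sum)

lemma Q_poly_nonzero: "Q_poly k a \<alpha> \<noteq> 0"
  unfolding Q_poly_def by (simp add: power_eq_0_iff del: power_Suc)

lemma poly_Q_poly_eq_0_iff: "poly (Q_poly k a \<alpha>) z = 0 \<longleftrightarrow> z \<in> a ` {1..k}"
  unfolding Q_poly_def by (auto simp: poly_prod poly_power)

lemma quotient_has_laurent_expansion:
  assumes "inj_on a {1..k}" "p \<in> {1..k}" "f holomorphic_on UNIV"
  shows "(\<lambda>x. f (a p + x) / poly (Q_poly k a \<alpha>) (a p + x)) has_laurent_expansion
    fls_shift (int (\<alpha> p + 1)) (fps_to_fls (fps_expansion f (a p) * b_fps k a \<alpha> p))"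
proof -
  have "f analytic_on {a p}"
    using assms(3) by (auto simp: analytic_on_open intro: analytic_on_subset[of f UNIV])
  then have "(\<lambda>x. f (a p + x)) has_fps_expansion fps_expansion f (a p)"
    by (rule analytic_at_imp_has_fps_expansion)
  then have "(\<lambda>x. f (a p + x) * (1 / poly (Qp_poly k a \<alpha> p) (a p + x))) has_fps_expansion
      fps_expansion f (a p) * b_fps k a \<alpha> p"
    by (rule has_fps_expansion_mult) (rule inverse_Qp_has_fps_expansion[OF assms(1,2)])
  then have "(\<lambda>x. f (a p + x) * (1 / poly (Qp_poly k a \<alpha> p) (a p + x))) has_laurent_expansion
      fps_to_fls (fps_expansion f (a p) * b_fps k a \<alpha> p)"
    by (rule has_laurent_expansion_fps)
  from has_laurent_expansion_shift'[OF this, of "int (\<alpha> p + 1)"] show ?thesis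
    by (simp add: Q_poly_eq_mult_Qp_poly[OF assms(2)] power_int_minus field_simps power_int_add
          del: of_nat_Suc)
qed

lemma is_pole_quotient_imp_root:
  assumes "f holomorphic_on UNIV" "is_pole (\<lambda>w. f w / poly Q w) w"
  shows "poly Q w = 0"
proof (rule ccontr)
  assume "poly Q w \<noteq> 0"
  moreover have "f analytic_on {w}"
    using assms(1) by (auto simp: analytic_on_open intro: analytic_on_subset[of f UNIV])
  moreover have "poly Q analytic_on {w}"
    by (rule has_fps_expansion_imp_analytic[OF has_fps_expansion_poly_shift])
  ultimately have "(\<lambda>w. f w / poly Q w) analytic_on {w}"
    by (intro analytic_intros) auto
  then show False
    using assms(2) analytic_at_imp_no_pole by blast
qed

lemma poly_hermite_poly:
  assumes "inj_on a {1..k}" "f holomorphic_on UNIV" "poly (Q_poly k a \<alpha>) z \<noteq> 0"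
  shows "poly (hermite_poly k a \<alpha> f) z
    = poly (Q_poly k a \<alpha>) z * singular_part (\<lambda>w. f w / poly (Q_poly k a \<alpha>) w) z"
proof -
  let ?g = "\<lambda>w. f w / poly (Q_poly k a \<alpha>) w"
  let ?s = "\<lambda>w. poly (fls_prpart (laurent_expansion ?g w)) (1 / (z - w))"
  have laurent: "laurent_expansion ?g (a p)
      = fls_shift (int (\<alpha> p + 1)) (fps_to_fls (fps_expansion f (a p) * b_fps k a \<alpha> p))"
    if "p \<in> {1..k}" for p
    using quotient_has_laurent_expansion[OF assms(1) that assms(2)] by (rule laurent_expansion_eqI)
  have "singular_part ?g z = (\<Sum>w\<in>a ` {1..k}. ?s w)"
    unfolding singular_part_def
  \<comment> \<open>A root of Q need not be a pole, as \<open>f\<close> may cancel the zero. Such a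
    root has no negative Laurent terms and contributes 0, so the sum may run over all roots.\<close>
  proof (rule sum.mono_neutral_left)
    show "{w. is_pole ?g w} \<subseteq> a ` {1..k}"
      using is_pole_quotient_imp_root[OF assms(2)] poly_Q_poly_eq_0_iff by blast
    show "\<forall>w\<in>a ` {1..k} - {w. is_pole ?g w}. ?s w = 0"
    proof
      fix w assume w: "w \<in> a ` {1..k} - {w. is_pole ?g w}"
      then obtain p where p: "p \<in> {1..k}" "w = a p" by blast
      have "fls_subdegree (laurent_expansion ?g w) \<ge> 0"
        using is_pole_fls_subdegree_iff[OF quotient_has_laurent_expansion[OF assms(1) p(1) assms(2)]]
          laurent[OF p(1)] w p(2) by (metis DiffD2 mem_Collect_eq not_le)
      then show "?s w = 0" by (simp add: fls_prpart_eq0_iff[THEN iffD2])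
    qed
  qed simp
  also have "\<dots> = (\<Sum>p=1..k. ?s (a p))"
    using assms(1) by (simp add: sum.reindex)
  finally have "poly (Q_poly k a \<alpha>) z * singular_part ?g z
      = (\<Sum>p=1..k. poly (Q_poly k a \<alpha>) z * ?s (a p))"
    by (simp add: sum_distrib_left)
  also have "\<dots> = poly (hermite_poly k a \<alpha> f) z"
    unfolding hermite_poly_eq[OF assms(1)] poly_sum
  proof (intro sum.cong refl)
    fix p assume p: "p \<in> {1..k}"
    have nz: "z - a p \<noteq> 0"
      using assms(3) p poly_Q_poly_eq_0_iff by auto
    show "poly (Q_poly k a \<alpha>) z * ?s (a p) = poly ((\<Sum>q=0..\<alpha> p.
        smult (fps_nth (fps_expansion f (a p) * b_fps k a \<alpha> p) q) ([:- a p, 1:] ^ q)) * Qp_poly k a \<alpha> p) z"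
      unfolding laurent[OF p] poly_fls_prpart_shift[OF nz]
      using nz by (simp add: Q_poly_eq_mult_Qp_poly[OF p] poly_sum del: power_Suc)
  qed
  finally show ?thesis by simp
qed

text \<open>The polynomial is determined by its values off the zeros of Q, so the pointwise identity
  \<open>poly_hermite_poly\<close> identifies it.\<close>

lemma sing_poly_eq_hermite_poly:
  assumes "inj_on a {1..k}" "f holomorphic_on UNIV"
  shows "sing_poly f (Q_poly k a \<alpha>) = hermite_poly k a \<alpha> f"
  unfolding sing_poly_def
  by (rule the1_equality[OF sing_poly_exists_unique[OF assms(2) Q_poly_nonzero]])
     (auto intro: poly_hermite_poly[OF assms])

subsection \<open>Divisibility by the annihilating polynomial\<close>

text \<open>Translating \<open>w\<close> to 0 turns the claim into divisibility by a power of X,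
  which the low coefficients decide; translating back preserves the factorisation.\<close>

lemma power_linear_dvd_if_coeff_pcompose:
  fixes E :: "'a :: comm_ring_1 poly"
  assumes "\<And>i. i < m \<Longrightarrow> coeff (E \<circ>\<^sub>p [:w, 1:]) i = 0"
  shows "[:- w, 1:] ^ m dvd E"
proof -
  have "monom 1 m dvd E \<circ>\<^sub>p [:w, 1:]"
    using assms by (simp add: monom_1_dvd_iff')
  then obtain G where G: "E \<circ>\<^sub>p [:w, 1:] = [:0, 1:] ^ m * G"
    by (auto simp: dvd_def monom_altdef)
  have "E = (E \<circ>\<^sub>p [:w, 1:]) \<circ>\<^sub>p [:- w, 1:]"
    by (simp add: pcompose_pCons pcompose_idR flip: pcompose_assoc)
  also have "\<dots> = [:- w, 1:] ^ m * (G \<circ>\<^sub>p [:- w, 1:])"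
    by (simp add: G pcompose_mult pcompose_power pcompose_pCons)
  finally show ?thesis by simp
qed

lemma prod_power_linear_dvd:
  fixes E :: "'a :: idom poly"
  assumes "finite S" "inj_on a S" "\<And>p. p \<in> S \<Longrightarrow> [:- a p, 1:] ^ n p dvd E"
  shows "(\<Prod>p\<in>S. [:- a p, 1:] ^ n p) dvd E"
  using assms
proof (induction S rule: finite_induct)
  case (insert x S)
  then obtain G where G: "E = (\<Prod>p\<in>S. [:- a p, 1:] ^ n p) * G"
    by (auto simp: dvd_def)
  \<comment> \<open>The nodes are distinct, so the factors already split off do not vanish at
    \<open>a x\<close>, and the whole order of \<open>E\<close> at \<open>a x\<close> must come from
    \<open>G\<close>.\<close>
  have "poly (\<Prod>p\<in>S. [:- a p, 1:] ^ n p) (a x) \<noteq> 0"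
    using insert.hyps insert.prems(1) by (auto simp: poly_prod poly_power)
  then have "order (a x) (\<Prod>p\<in>S. [:- a p, 1:] ^ n p) = 0" "(\<Prod>p\<in>S. [:- a p, 1:] ^ n p) \<noteq> 0"
    by (rule order_0I, force)
  moreover have "[:- a x, 1:] ^ n x dvd E"
    using insert.prems(2) by simp
  ultimately have "[:- a x, 1:] ^ n x dvd G"
    unfolding G by (cases "G = 0") (simp_all add: order_divides order_mult)
  then show ?case
    unfolding G using insert.hyps by (simp add: mult_dvd_mono mult.commute)
qed simp

lemma fps_cutoff_Suc_eq_sum:
  "fps_cutoff (Suc m) H = (\<Sum>q=0..m. fps_const (fps_nth H q) * fps_X ^ q)"
  for H :: "'a :: comm_ring_1 fps"
  by (rule fps_ext) (auto simp: fps_sum_nth fps_X_power_iff if_distrib sum.delta cong: if_cong)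

text \<open>In powers of z - a_p, let H = F/Q_p. Then F = H Q_p, while the subtracted term is the
  truncation of H times Q_p, so the difference contains only the tail of H.\<close>

lemma power_linear_dvd_hermite_diff_term:
  fixes F :: "complex poly"
  assumes "inj_on a {1..k}" "p \<in> {1..k}"
  shows "[:- a p, 1:] ^ (\<alpha> p + 1) dvd F - (\<Sum>q=0..\<alpha> p.
     smult (fps_nth (fps_expansion (poly F) (a p) * b_fps k a \<alpha> p) q) ([:- a p, 1:] ^ q)) * Qp_poly k a \<alpha> p"
    (is "_ dvd F - ?T * _")
proof (rule power_linear_dvd_if_coeff_pcompose)
  let ?\<phi> = "\<lambda>P. fps_of_poly (P \<circ>\<^sub>p [:a p, 1:])"
  let ?B = "b_fps k a \<alpha> p" and ?G = "?\<phi> (Qp_poly k a \<alpha> p)"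
  define H where "H = ?\<phi> F * ?B"
  have exp: "fps_expansion (poly F) (a p) = ?\<phi> F"
    by (rule fps_expansion_shift_eqI[OF has_fps_expansion_poly_shift])
  have "?\<phi> ?T = fps_cutoff (\<alpha> p + 1) H"
    by (simp add: exp H_def fps_cutoff_Suc_eq_sum pcompose_sum pcompose_smult pcompose_power
          pcompose_pCons fps_of_poly_sum fps_of_poly_smult fps_of_poly_power fps_of_poly_pCons)
  moreover have "?\<phi> F = H * ?G"
    using Qp_fps_mult_b_fps[OF assms, of \<alpha>] by (simp add: H_def mult_ac)
  ultimately have "?\<phi> (F - ?T * Qp_poly k a \<alpha> p) = (H - fps_cutoff (\<alpha> p + 1) H) * ?G"
    by (simp add: pcompose_diff pcompose_mult fps_of_poly_diff fps_of_poly_mult algebra_simps)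
  also have "\<dots> = fps_X ^ (\<alpha> p + 1) * (fps_shift (\<alpha> p + 1) H * ?G)"
    using fps_shift_cutoff'[of "\<alpha> p + 1" H] by (metis add_diff_cancel_right' mult.assoc)
  finally have eq: "?\<phi> (F - ?T * Qp_poly k a \<alpha> p) = \<dots>" .
  fix i assume "i < \<alpha> p + 1"
  then have "fps_nth (?\<phi> (F - ?T * Qp_poly k a \<alpha> p)) i = 0"
    unfolding eq by (simp only: fps_X_power_mult_nth if_True)
  then show "coeff ((F - ?T * Qp_poly k a \<alpha> p) \<circ>\<^sub>p [:a p, 1:]) i = 0" by simp
qed

text \<open>At each node only the summand of that node matters: every other summand has a cofactor
  that still contains the full power of z - a_p.\<close>

lemma Q_poly_dvd_diff_hermite_poly:
  fixes F :: "complex poly"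
  assumes "inj_on a {1..k}"
  shows "Q_poly k a \<alpha> dvd F - hermite_poly k a \<alpha> (poly F)"
  unfolding Q_poly_def
proof (rule prod_power_linear_dvd)
  fix p assume p: "p \<in> {1..k}"
  let ?T = "\<lambda>p. (\<Sum>q=0..\<alpha> p.
     smult (fps_nth (fps_expansion (poly F) (a p) * b_fps k a \<alpha> p) q) ([:- a p, 1:] ^ q)) * Qp_poly k a \<alpha> p"
  have "hermite_poly k a \<alpha> (poly F) = ?T p + (\<Sum>p'\<in>{1..k} - {p}. ?T p')"
    unfolding hermite_poly_eq[OF assms] by (rule sum.remove[OF finite_atLeastAtMost p])
  then have eq: "F - hermite_poly k a \<alpha> (poly F) = (F - ?T p) - (\<Sum>p'\<in>{1..k} - {p}. ?T p')"
    by simp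
  have "[:- a p, 1:] ^ (\<alpha> p + 1) dvd ?T p'" if "p' \<in> {1..k} - {p}" for p'
  proof (rule dvd_mult)
    show "[:- a p, 1:] ^ (\<alpha> p + 1) dvd Qp_poly k a \<alpha> p'"
      using that p by (subst Qp_poly_eq) (auto intro!: dvd_prodI simp del: power_Suc)
  qed
  then show "[:- a p, 1:] ^ (\<alpha> p + 1) dvd F - hermite_poly k a \<alpha> (poly F)"
    unfolding eq by (intro dvd_diff[OF power_linear_dvd_hermite_diff_term[OF assms p]] dvd_sum)
qed (use assms in auto)

subsection \<open>Evaluation at a matrix\<close>

lemma matrix_smult_nth [simp]: "matrix_smult c A $ i $ j = c * A $ i $ j"
  by (simp add: matrix_smult_def map_matrix_def)

lemma linear_matrix_smult: "linear (\<lambda>c. matrix_smult c A)"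
  by (rule linearI) (simp_all add: vec_eq_iff algebra_simps)

lemma matrix_smult_assoc: "matrix_smult c (matrix_smult d A) = matrix_smult (c * d) A"
  by (simp add: vec_eq_iff)

lemma matrix_smult_sum: "matrix_smult c (sum f S) = (\<Sum>x\<in>S. matrix_smult c (f x))"
  by (simp add: vec_eq_iff sum_distrib_left)

lemma poly_matrix_eq_sum:
  assumes "degree P \<le> N"
  shows "poly_matrix P A = (\<Sum>i\<le>N. matrix_smult (coeff P i) (matrix_power A i))"
  unfolding poly_matrix_def
  by (rule sum.mono_neutral_left) (use assms in \<open>auto simp: coeff_eq_0 vec_eq_iff\<close>)

lemma poly_matrix_add: "poly_matrix (P + R) A = poly_matrix P A + poly_matrix R A"
proof -
  let ?N = "max (degree P) (degree R)"
  have "degree (P + R) \<le> ?N" by (rule degree_add_le_max)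
  then show ?thesis
    by (simp add: poly_matrix_eq_sum[of _ ?N] vec_eq_iff algebra_simps sum.distrib)
qed

lemma poly_matrix_0 [simp]: "poly_matrix 0 A = 0"
  by (simp add: poly_matrix_def vec_eq_iff)

lemma poly_matrix_smult: "poly_matrix (smult c P) A = matrix_smult c (poly_matrix P A)"
  by (subst poly_matrix_eq_sum[of _ "degree P"])
     (simp_all add: poly_matrix_def degree_smult_le matrix_smult_sum matrix_smult_assoc)

lemma poly_matrix_sum: "poly_matrix (sum P S) A = (\<Sum>x\<in>S. poly_matrix (P x) A)"
  by (induction S rule: infinite_finite_induct) (simp_all add: poly_matrix_add)

lemma poly_matrix_monom: "poly_matrix (monom 1 n) A = matrix_power A n"
proof -
  have "poly_matrix (monom 1 n) A = (\<Sum>i\<in>{n}. matrix_smult (coeff (monom 1 n) i) (matrix_power A i))"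
    unfolding poly_matrix_def
    by (rule sum.mono_neutral_right) (auto simp: degree_monom_eq vec_eq_iff)
  then show ?thesis by (simp add: vec_eq_iff)
qed

lemma matrix_mult_matrix_smult: "A ** matrix_smult c B = matrix_smult c (A ** B)"
  by (simp add: vec_eq_iff matrix_matrix_mult_def sum_distrib_left mult_ac)

lemma matrix_mult_sum: "A ** sum f S = (\<Sum>x\<in>S. A ** f x)" for A :: "complex^'n^'n"
  by (induction S rule: infinite_finite_induct) (simp_all add: matrix_add_ldistrib)

lemma poly_matrix_pCons_0: "poly_matrix (pCons 0 P) A = A ** poly_matrix P A"
proof -
  have "poly_matrix (pCons 0 P) A
      = (\<Sum>i\<le>Suc (degree P). matrix_smult (coeff (pCons 0 P) i) (matrix_power A i))"
    by (rule poly_matrix_eq_sum) (rule degree_pCons_le)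
  also have "\<dots> = (\<Sum>i\<le>degree P. matrix_smult (coeff P i) (matrix_power A (Suc i)))"
    by (subst sum.atMost_Suc_shift) (simp add: vec_eq_iff)
  finally show ?thesis
    by (simp add: poly_matrix_def matrix_mult_sum matrix_mult_matrix_smult)
qed

text \<open>Horner's scheme on the cofactor: (c + zD)Q evaluates at \<open>A\<close> to c Q(A) plus
  \<open>A\<close> times (DQ)(A), and both terms vanish.\<close>

lemma poly_matrix_mult_eq_0:
  assumes "poly_matrix Q A = 0"
  shows "poly_matrix (D * Q) A = 0"
proof (induction D)
  case (pCons c D)
  then show ?case
    using assms
    by (simp add: mult_pCons_left poly_matrix_add poly_matrix_smult poly_matrix_pCons_0)
       (simp add: vec_eq_iff)
qed simp

lemma poly_matrix_eqI:
  assumes "poly_matrix Q A = 0" "Q dvd P - R"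
  shows "poly_matrix P A = poly_matrix R A"
proof -
  obtain D where "P - R = Q * D" using assms(2) by (rule dvdE)
  then have "P = D * Q + R" by (simp add: algebra_simps)
  then show ?thesis
    using poly_matrix_mult_eq_0[OF assms(1), of D] by (simp add: poly_matrix_add)
qed

section \<open>Termwise differentiation and the power series in A\<close>

lemma higher_deriv_has_fps_expansion:
  fixes f :: "complex \<Rightarrow> complex"
  assumes "f has_fps_expansion F"
  shows "(deriv ^^ j) f has_fps_expansion (fps_deriv ^^ j) F"
  using assms by (induction j) (auto intro: has_fps_expansion_deriv)

lemma fps_nth_higher_deriv:
  "fps_nth ((fps_deriv ^^ j) F) n = pochhammer (of_nat (Suc n)) j * fps_nth F (n + j)"
  for F :: "'a :: comm_ring_1 fps"
  by (induction j arbitrary: n) (simp_all add: pochhammer_rec algebra_simps)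

lemma higher_deriv_sums:
  fixes f :: "complex \<Rightarrow> complex"
  assumes "f holomorphic_on UNIV"
  shows "(\<lambda>n. taylor_coeff f 0 n * (deriv ^^ j) (\<lambda>z. z ^ n) w) sums (deriv ^^ j) f w"
proof -
  let ?c = "taylor_coeff f 0"
  have "f analytic_on {0}"
    using assms by (auto simp: analytic_on_open intro: analytic_on_subset[of f UNIV])
  then have "f has_fps_expansion fps_expansion f 0"
    by (rule analytic_at_imp_has_fps_expansion_0)
  then have "(deriv ^^ j) f has_fps_expansion (fps_deriv ^^ j) (fps_expansion f 0)"
    by (rule higher_deriv_has_fps_expansion)
  moreover have "(deriv ^^ j) f holomorphic_on eball 0 \<infinity>"
    using holomorphic_higher_deriv[OF assms open_UNIV] holomorphic_on_subset by blast
  ultimately have "(\<lambda>n. fps_nth ((fps_deriv ^^ j) (fps_expansion f 0)) n * w ^ n) sums (deriv ^^ j) f w"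
    by (rule has_fps_expansion_imp_sums_complex) simp
  moreover have deriv: "(deriv ^^ j) (\<lambda>z. z ^ n) w = pochhammer (of_nat (Suc n - j)) j * w ^ (n - j)" for n
    using higher_deriv_power[of j 0 n w] by simp
  \<comment> \<open>Coefficient \<open>n\<close> of the j-th derivative comes from the monomial of
    exponent \<open>n + j\<close>, so the series first appears with shifted index.\<close>
  ultimately have "(\<lambda>n. ?c (n + j) * (deriv ^^ j) (\<lambda>z. z ^ (n + j)) w) sums (deriv ^^ j) f w"
    by (simp add: fps_nth_higher_deriv taylor_coeff_def mult_ac Suc_diff_le)
  \<comment> \<open>For \<open>n < j\<close> the truncated difference \<open>Suc n - j\<close> is 0,
    and the rising factorial of 0 of positive length vanishes; the shift can then be undone.\<close>
  moreover have "?c n * (deriv ^^ j) (\<lambda>z. z ^ n) w = 0" if "n < j" for n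
    using that by (simp add: deriv pochhammer_0_left)
  ultimately show ?thesis
    by (subst (asm) sums_iff_shift) simp
qed

lemma power_series_matrix_sums:
  fixes A :: "complex^'n^'n"
  assumes "inj_on a {1..k}" "poly_matrix (Q_poly k a \<alpha>) A = 0" "f holomorphic_on UNIV"
  shows "(\<lambda>n. matrix_smult (taylor_coeff f 0 n) (matrix_power A n)) sums
           poly_matrix (hermite_poly k a \<alpha> f) A"
proof -
  let ?c = "taylor_coeff f 0"
  let ?R = "\<lambda>p q. poly_matrix ([:- a p, 1:] ^ q * Qp_poly k a \<alpha> p) A"
  let ?b = "\<lambda>p q j. inverse (fact j) * b_coeff k a \<alpha> p (q - j)"
  \<comment> \<open>The matrices \<open>?R p q\<close> do not depend on \<open>g\<close>; only the
    scalar derivatives of \<open>g\<close> at the nodes do.\<close>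
  have expand: "poly_matrix (hermite_poly k a \<alpha> g) A = (\<Sum>p=1..k. \<Sum>q=0..\<alpha> p. \<Sum>j=0..q.
      matrix_smult ((deriv ^^ j) g (a p) * ?b p q j) (?R p q))" for g
    by (simp add: hermite_poly_def poly_matrix_sum poly_matrix_smult divide_inverse mult.assoc)
  have power: "matrix_power A n = poly_matrix (hermite_poly k a \<alpha> (\<lambda>z. z ^ n)) A" for n
  proof -
    have "(\<lambda>z. z ^ n) = poly (monom 1 n :: complex poly)"
      by (simp add: fun_eq_iff poly_monom)
    then have "Q_poly k a \<alpha> dvd monom 1 n - hermite_poly k a \<alpha> (\<lambda>z. z ^ n)"
      using Q_poly_dvd_diff_hermite_poly[OF assms(1)] by simp
    from poly_matrix_eqI[OF assms(2) this] show ?thesis by (simp add: poly_matrix_monom)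
  qed
  have "(\<lambda>n. matrix_smult (?c n * (deriv ^^ j) (\<lambda>z. z ^ n) (a p) * ?b p q j) (?R p q)) sums
      matrix_smult ((deriv ^^ j) f (a p) * ?b p q j) (?R p q)" for p q j
    \<comment> \<open>A real-linear map on the finite-dimensional space of complex numbers is
      bounded, so it carries the convergent scalar series to a convergent matrix series.\<close>
    by (intro bounded_linear.sums[OF linear_matrix_smult[unfolded linear_conv_bounded_linear]]
          sums_mult2 higher_deriv_sums assms(3))
  then have "(\<lambda>n. \<Sum>p=1..k. \<Sum>q=0..\<alpha> p. \<Sum>j=0..q.
        matrix_smult (?c n * (deriv ^^ j) (\<lambda>z. z ^ n) (a p) * ?b p q j) (?R p q)) sums
      poly_matrix (hermite_poly k a \<alpha> f) A"
    unfolding expand by (intro sums_sum)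
  then show ?thesis
    by (simp only: power expand matrix_smult_sum matrix_smult_assoc mult.assoc)
qed

theorem mainTheorem1:
  fixes A :: "complex^'n^'n"
    and k :: nat
    and a :: "nat \<Rightarrow> complex"
    and \<alpha> :: "nat \<Rightarrow> nat"
    and f :: "complex \<Rightarrow> complex"
  assumes "k \<ge> 1"
    and "inj_on a {1..k}"
    and "poly_matrix (Q_poly k a \<alpha>) A = 0"
    and "f holomorphic_on UNIV"
  shows "(\<forall>p\<in>{1..k}. \<forall>n. b_coeff k a \<alpha> p n =
           (-1) ^ n *
           (\<Sum>\<beta> \<in> {\<beta> \<in> {1..k} \<rightarrow>\<^sub>E (UNIV :: nat set). \<beta> p = 0 \<and> (\<Sum>j=1..k. \<beta> j) = n}.
              \<Prod>j\<in>{1..k} - {p}.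
                of_nat ((\<alpha> j + \<beta> j) choose \<alpha> j) * (1 / (a p - a j) ^ (\<alpha> j + 1 + \<beta> j))))
    \<and> sing_poly f (Q_poly k a \<alpha>) =
           (\<Sum>p=1..k. \<Sum>q=0..\<alpha> p. \<Sum>j=0..q.
              smult ((deriv ^^ j) f (a p) / fact j * b_coeff k a \<alpha> p (q - j))
                ([:- a p, 1:] ^ q * Qp_poly k a \<alpha> p))
    \<and> (\<lambda>n. matrix_smult (taylor_coeff f 0 n) (matrix_power A n)) sums
           poly_matrix (sing_poly f (Q_poly k a \<alpha>)) A"
proof (intro conjI ballI allI)
  show "(\<lambda>n. matrix_smult (taylor_coeff f 0 n) (matrix_power A n)) sums
      poly_matrix (sing_poly f (Q_poly k a \<alpha>)) A"
    unfolding sing_poly_eq_hermite_poly[OF assms(2,4)]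
    by (rule power_series_matrix_sums[OF assms(2-4)])
qed (rule b_coeff_formula[OF assms(2)] sing_poly_eq_hermite_poly[OF assms(2,4), unfolded hermite_poly_def]; assumption?)+

end
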